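(* Let $\mathsf{C}$ be a category with an initial object $0$ and $(T,\mu,\eta)$ a monad on $\mathsf{C}$ such that $\mathcal{K}l(T)$ is $\mathbf{Cppo}$-enriched, and assume that $\perp\cdot f^\sharp=\perp$ for every morphism $f:X\to Y$ in $\mathsf{C}$ (with $\perp$ the least element of the relevant hom-set). For $\alpha:X\multimap X$ define $\mathrm{tr}_\alpha:X\multimap 0$ by $\mathrm{tr}_\alpha=\mu x.(x\cdot\alpha)=\bigvee_{n\in\mathbb{N}}\perp\cdot\alpha^{n}$. Then $\mathrm{tr}_{(-)}$ is a coalgebraic trace operator on $\mathcal{K}l(T)$, i.e. a fixed point operator on $\mathcal{K}l(T)$ that is uniform with respect to $(-)^\sharp:\mathsf{C}\to\mathcal{K}l(T)$.
   Context: $\mathcal{K}l(T)$: objects of $\mathsf{C}$, morphisms $X\multimap Y$ are $\mathsf{C}$-morphisms $X\to TY$, composition $g\cdot f=\mu_Z\circ Tg\circ f$, identities $\eta_X$; $f^\sharp=\eta_Y\circ f$ for $f:X\to Y$ in $\mathsf{C}$; $0$ is also initial in $\mathcal{K}l(T)$; $\alpha^0$ is the identity. $\mathbf{Cppo}$-enriched: every hom-set is a poset with least element $\perp$, ascending $\omega$-chains have suprema, and composition on either side preserves suprema of ascending $\omega$-chains (and is monotone). A fixed point operator on $\mathcal{K}l(T)$ is a family of maps $\mathrm{f}:Hom_{\mathcal{K}l(T)}(X,X)\to Hom_{\mathcal{K}l(T)}(X,0)$ with $\mathrm{f}(\alpha)\cdot\alpha=\mathrm{f}(\alpha)$ for all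 $\alpha:X\multimap X$. It is uniform w.r.t. $(-)^\sharp$ if for all $\alpha:X\multimap X$, $\beta:Y\multimap Y$ and $h:X\to Y$ in $\mathsf{C}$, $h^\sharp\cdot\alpha=\beta\cdot h^\sharp$ implies $\mathrm{f}(\beta)\cdot h^\sharp=\mathrm{f}(\alpha)$. A uniform fixed point operator is called a coalgebraic trace operator. *)

theory Defs
  imports "HOL-Algebra.Complete_Lattice"
begin

text \<open>
  Categories are given by hom-sets; composition is indexed by the three objects involved, so
  hom-sets need not be disjoint. In particular a morphism \<open>X \<rightarrow> T Y\<close> can be used as it stands as a
  Kleisli morphism from \<open>X\<close> to \<open>Y\<close>, even when \<open>T\<close> is not injective on objects.
  \<open>Comp C X Y Z g f\<close> is \<open>g\<close> after \<open>f\<close>, for \<open>f : X \<rightarrow> Y\<close> and \<open>g : Y \<rightarrow> Z\<close>.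
\<close>

record ('o, 'a) cat =
  Ob :: "'o set"
  Hom :: "'o \<Rightarrow> 'o \<Rightarrow> 'a set"
  Comp :: "'o \<Rightarrow> 'o \<Rightarrow> 'o \<Rightarrow> 'a \<Rightarrow> 'a \<Rightarrow> 'a"
  Id :: "'o \<Rightarrow> 'a"

locale category =
  fixes C :: "('o, 'a) cat"
  assumes Id_hom: "X \<in> Ob C \<Longrightarrow> Id C X \<in> Hom C X X"
    and Comp_hom: "\<lbrakk>X \<in> Ob C; Y \<in> Ob C; Z \<in> Ob C; f \<in> Hom C X Y; g \<in> Hom C Y Z\<rbrakk>
      \<Longrightarrow> Comp C X Y Z g f \<in> Hom C X Z"
    and Comp_Id_left: "\<lbrakk>X \<in> Ob C; Y \<in> Ob C; f \<in> Hom C X Y\<rbrakk> \<Longrightarrow> Comp C X Y Y (Id C Y) f = f"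
    and Comp_Id_right: "\<lbrakk>X \<in> Ob C; Y \<in> Ob C; f \<in> Hom C X Y\<rbrakk> \<Longrightarrow> Comp C X X Y f (Id C X) = f"
    and Comp_assoc: "\<lbrakk>W \<in> Ob C; X \<in> Ob C; Y \<in> Ob C; Z \<in> Ob C;
        f \<in> Hom C W X; g \<in> Hom C X Y; h \<in> Hom C Y Z\<rbrakk>
      \<Longrightarrow> Comp C W X Z (Comp C X Y Z h g) f = Comp C W Y Z h (Comp C W X Y g f)"

definition initial_object :: "('o, 'a) cat \<Rightarrow> 'o \<Rightarrow> bool" where
  "initial_object C z \<longleftrightarrow> z \<in> Ob C \<and> (\<forall>X \<in> Ob C. \<exists>!f. f \<in> Hom C z X)"

primrec iter :: "('o, 'a) cat \<Rightarrow> 'o \<Rightarrow> 'a \<Rightarrow> nat \<Rightarrow> 'a" where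
  "iter C X \<alpha> 0 = Id C X"
| "iter C X \<alpha> (Suc n) = Comp C X X X \<alpha> (iter C X \<alpha> n)"

locale cat_functor = source: category C + target: category D
  for C :: "('o, 'a) cat" and D :: "('p, 'b) cat" +
  fixes F :: "'o \<Rightarrow> 'p" and Fm :: "'o \<Rightarrow> 'o \<Rightarrow> 'a \<Rightarrow> 'b"
  assumes map_ob: "X \<in> Ob C \<Longrightarrow> F X \<in> Ob D"
    and map_hom: "\<lbrakk>X \<in> Ob C; Y \<in> Ob C; f \<in> Hom C X Y\<rbrakk> \<Longrightarrow> Fm X Y f \<in> Hom D (F X) (F Y)"
    and map_Id: "X \<in> Ob C \<Longrightarrow> Fm X X (Id C X) = Id D (F X)"
    and map_Comp: "\<lbrakk>X \<in> Ob C; Y \<in> Ob C; Z \<in> Ob C; f \<in> Hom C X Y; g \<in> Hom C Y Z\<rbrakk>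
      \<Longrightarrow> Fm X Z (Comp C X Y Z g f) = Comp D (F X) (F Y) (F Z) (Fm Y Z g) (Fm X Y f)"

locale nat_transformation = source: cat_functor C D F Fm + target: cat_functor C D G Gm
  for C :: "('o, 'a) cat" and D :: "('p, 'b) cat" and F Fm G Gm +
  fixes \<tau> :: "'o \<Rightarrow> 'b"
  assumes component: "X \<in> Ob C \<Longrightarrow> \<tau> X \<in> Hom D (F X) (G X)"
    and natural: "\<lbrakk>X \<in> Ob C; Y \<in> Ob C; f \<in> Hom C X Y\<rbrakk>
      \<Longrightarrow> Comp D (F X) (F Y) (G Y) (\<tau> Y) (Fm X Y f) = Comp D (F X) (G X) (G Y) (Gm X Y f) (\<tau> X)"

record ('o, 'a) monad_data =
  T_ob :: "'o \<Rightarrow> 'o"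
  T_map :: "'o \<Rightarrow> 'o \<Rightarrow> 'a \<Rightarrow> 'a"
  mult :: "'o \<Rightarrow> 'a"
  unit :: "'o \<Rightarrow> 'a"

locale monad =
  T: cat_functor C C "T_ob T" "T_map T" +
  unit: nat_transformation C C "\<lambda>X. X" "\<lambda>X Y f. f" "T_ob T" "T_map T" "unit T" +
  mult: nat_transformation C C
    "\<lambda>X. T_ob T (T_ob T X)" "\<lambda>X Y f. T_map T (T_ob T X) (T_ob T Y) (T_map T X Y f)"
    "T_ob T" "T_map T" "mult T"
  for C :: "('o, 'a) cat" and T :: "('o, 'a) monad_data" +
  assumes mult_assoc: "X \<in> Ob C \<Longrightarrow>
      Comp C (T_ob T (T_ob T (T_ob T X))) (T_ob T (T_ob T X)) (T_ob T X)
        (mult T X) (T_map T (T_ob T (T_ob T X)) (T_ob T X) (mult T X)) =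
      Comp C (T_ob T (T_ob T (T_ob T X))) (T_ob T (T_ob T X)) (T_ob T X)
        (mult T X) (mult T (T_ob T X))"
    and mult_unit: "X \<in> Ob C \<Longrightarrow>
      Comp C (T_ob T X) (T_ob T (T_ob T X)) (T_ob T X) (mult T X) (unit T (T_ob T X)) =
      Id C (T_ob T X)"
    and mult_map_unit: "X \<in> Ob C \<Longrightarrow>
      Comp C (T_ob T X) (T_ob T (T_ob T X)) (T_ob T X)
        (mult T X) (T_map T X (T_ob T X) (unit T X)) =
      Id C (T_ob T X)"

definition kleisli :: "('o, 'a) cat \<Rightarrow> ('o, 'a) monad_data \<Rightarrow> ('o, 'a) cat" where
  "kleisli C T =
    \<lparr>Ob = Ob C,
     Hom = (\<lambda>X Y. Hom C X (T_ob T Y)),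
     Comp = (\<lambda>X Y Z g f.
       Comp C X (T_ob T (T_ob T Z)) (T_ob T Z) (mult T Z)
         (Comp C X (T_ob T Y) (T_ob T (T_ob T Z)) (T_map T Y (T_ob T Z) g) f)),
     Id = unit T\<rparr>"

definition sharp :: "('o, 'a) cat \<Rightarrow> ('o, 'a) monad_data \<Rightarrow> 'o \<Rightarrow> 'o \<Rightarrow> 'a \<Rightarrow> 'a" where
  "sharp C T X Y f = Comp C X Y (T_ob T Y) (unit T Y) f"

definition omega_chain :: "'a gorder \<Rightarrow> (nat \<Rightarrow> 'a) \<Rightarrow> bool" where
  "omega_chain L c \<longleftrightarrow> (\<forall>n. c n \<in> carrier L \<and> c n \<sqsubseteq>\<^bsub>L\<^esub> c (Suc n))"

locale cppo_enriched = category K for K :: "('o, 'a) cat" +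
  fixes P :: "'o \<Rightarrow> 'o \<Rightarrow> 'a gorder"
  assumes carrier_hom: "\<lbrakk>X \<in> Ob K; Y \<in> Ob K\<rbrakk> \<Longrightarrow> carrier (P X Y) = Hom K X Y"
    and hom_poset: "\<lbrakk>X \<in> Ob K; Y \<in> Ob K\<rbrakk> \<Longrightarrow> partial_order (P X Y)"
    and hom_bottom: "\<lbrakk>X \<in> Ob K; Y \<in> Ob K\<rbrakk> \<Longrightarrow> \<exists>b. least (P X Y) b (carrier (P X Y))"
    and hom_chain_sup: "\<lbrakk>X \<in> Ob K; Y \<in> Ob K; omega_chain (P X Y) c\<rbrakk>
      \<Longrightarrow> \<exists>s. is_lub (P X Y) s (range c)"
    and Comp_mono_left: "\<lbrakk>X \<in> Ob K; Y \<in> Ob K; Z \<in> Ob K; f \<in> Hom K X Y;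
        g \<in> Hom K Y Z; g' \<in> Hom K Y Z; g \<sqsubseteq>\<^bsub>P Y Z\<^esub> g'\<rbrakk>
      \<Longrightarrow> Comp K X Y Z g f \<sqsubseteq>\<^bsub>P X Z\<^esub> Comp K X Y Z g' f"
    and Comp_mono_right: "\<lbrakk>X \<in> Ob K; Y \<in> Ob K; Z \<in> Ob K; g \<in> Hom K Y Z;
        f \<in> Hom K X Y; f' \<in> Hom K X Y; f \<sqsubseteq>\<^bsub>P X Y\<^esub> f'\<rbrakk>
      \<Longrightarrow> Comp K X Y Z g f \<sqsubseteq>\<^bsub>P X Z\<^esub> Comp K X Y Z g f'"
    and Comp_sup_left: "\<lbrakk>X \<in> Ob K; Y \<in> Ob K; Z \<in> Ob K; f \<in> Hom K X Y;
        omega_chain (P Y Z) c; is_lub (P Y Z) s (range c)\<rbrakk>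
      \<Longrightarrow> is_lub (P X Z) (Comp K X Y Z s f) (range (\<lambda>n. Comp K X Y Z (c n) f))"
    and Comp_sup_right: "\<lbrakk>X \<in> Ob K; Y \<in> Ob K; Z \<in> Ob K; g \<in> Hom K Y Z;
        omega_chain (P X Y) c; is_lub (P X Y) s (range c)\<rbrakk>
      \<Longrightarrow> is_lub (P X Z) (Comp K X Y Z g s) (range (\<lambda>n. Comp K X Y Z g (c n)))"

definition fixed_point_operator :: "('o, 'a) cat \<Rightarrow> 'o \<Rightarrow> ('o \<Rightarrow> 'a \<Rightarrow> 'a) \<Rightarrow> bool" where
  "fixed_point_operator K z fx \<longleftrightarrow>
    (\<forall>X \<in> Ob K. \<forall>\<alpha> \<in> Hom K X X.
      fx X \<alpha> \<in> Hom K X z \<and> Comp K X X z (fx X \<alpha>) \<alpha> = fx X \<alpha>)"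

text \<open>Uniformity with respect to an identity-on-objects functor \<open>C \<rightarrow> K\<close> with action \<open>J\<close> on
  morphisms.\<close>

definition uniform_wrt ::
  "('o, 'b) cat \<Rightarrow> ('o, 'a) cat \<Rightarrow> ('o \<Rightarrow> 'o \<Rightarrow> 'b \<Rightarrow> 'a) \<Rightarrow> 'o \<Rightarrow> ('o \<Rightarrow> 'a \<Rightarrow> 'a) \<Rightarrow> bool" where
  "uniform_wrt C K J z fx \<longleftrightarrow>
    (\<forall>X \<in> Ob C. \<forall>Y \<in> Ob C. \<forall>\<alpha> \<in> Hom K X X. \<forall>\<beta> \<in> Hom K Y Y. \<forall>h \<in> Hom C X Y.
      Comp K X X Y (J X Y h) \<alpha> = Comp K X Y Y \<beta> (J X Y h) \<longrightarrow>
      Comp K X Y z (fx Y \<beta>) (J X Y h) = fx X \<alpha>)"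

definition coalgebraic_trace_operator ::
  "('o, 'a) cat \<Rightarrow> ('o, 'a) monad_data \<Rightarrow> 'o \<Rightarrow> ('o \<Rightarrow> 'a \<Rightarrow> 'a) \<Rightarrow> bool" where
  "coalgebraic_trace_operator C T z fx \<longleftrightarrow>
    fixed_point_operator (kleisli C T) z fx \<and>
    uniform_wrt C (kleisli C T) (sharp C T) z fx"

definition tr :: "('o, 'a) cat \<Rightarrow> ('o \<Rightarrow> 'o \<Rightarrow> 'a gorder) \<Rightarrow> 'o \<Rightarrow> 'o \<Rightarrow> 'a \<Rightarrow> 'a" where
  "tr K P z X \<alpha> = \<Squnion>\<^bsub>P X z\<^esub>(range (\<lambda>n. Comp K X X z \<bottom>\<^bsub>P X z\<^esub> (iter K X \<alpha> n)))"

end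

theory Submission
  imports Defs
begin

text \<open>
  Write \<open>c\<^sub>n = \<bottom> \<cdot> \<alpha>\<^sup>n\<close>. Continuity of precomposition turns \<open>tr\<^sub>\<alpha> \<cdot> \<alpha>\<close> into the supremum of the shifted
  chain \<open>c\<^sub>n\<^sub>+\<^sub>1\<close>, which is again \<open>tr\<^sub>\<alpha>\<close>, and \<open>x \<cdot> \<alpha> = x\<close> gives \<open>c\<^sub>n \<sqsubseteq> x \<cdot> \<alpha>\<^sup>n = x\<close>.
  If \<open>h \<cdot> \<alpha> = \<beta> \<cdot> h\<close> and \<open>\<bottom> \<cdot> h = \<bottom>\<close>, then \<open>\<bottom> \<cdot> \<beta>\<^sup>n \<cdot> h = \<bottom> \<cdot> h \<cdot> \<alpha>\<^sup>n = \<bottom> \<cdot> \<alpha>\<^sup>n\<close>, so precomposing the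
  chain of \<open>\<beta>\<close> with \<open>h\<close> gives the chain of \<open>\<alpha>\<close>, and uniformity follows by continuity.
\<close>

context category
begin

lemma iter_hom: "X \<in> Ob C \<Longrightarrow> \<alpha> \<in> Hom C X X \<Longrightarrow> iter C X \<alpha> n \<in> Hom C X X"
  by (induction n) (auto intro: Id_hom Comp_hom)

text \<open>Induction moves \<open>h\<close> past one factor at a time. The instance
  \<open>h = \<alpha> = \<beta>\<close> says that \<open>\<alpha>\<close> commutes with its own
  powers, which lets a factor be split off on either side although \<open>iter\<close> adds it on
  the left.\<close>

lemma Comp_iter_commute:
  assumes "X \<in> Ob C" "Y \<in> Ob C" "\<alpha> \<in> Hom C X X" "\<beta> \<in> Hom C Y Y" "h \<in> Hom C X Y"
    and "Comp C X X Y h \<alpha> = Comp C X Y Y \<beta> h"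
  shows "Comp C X X Y h (iter C X \<alpha> n) = Comp C X Y Y (iter C Y \<beta> n) h"
proof (induction n)
  case 0
  then show ?case using assms by (simp add: Comp_Id_left Comp_Id_right)
next
  case (Suc n)
  have "Comp C X X Y h (iter C X \<alpha> (Suc n)) = Comp C X X Y (Comp C X X Y h \<alpha>) (iter C X \<alpha> n)"
    using assms(1-5) by (simp add: Comp_assoc iter_hom)
  also have "\<dots> = Comp C X Y Y \<beta> (Comp C X X Y h (iter C X \<alpha> n))"
    unfolding assms(6) using assms(1-5) by (simp add: Comp_assoc iter_hom)
  also have "\<dots> = Comp C X Y Y (iter C Y \<beta> (Suc n)) h"
    using assms(1-5) by (simp add: Suc Comp_assoc iter_hom)
  finally show ?case .
qed

lemma Comp_iter_fixed:
  assumes "X \<in> Ob C" "Y \<in> Ob C" "\<alpha> \<in> Hom C X X" "x \<in> Hom C X Y" "Comp C X X Y x \<alpha> = x"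
  shows "Comp C X X Y x (iter C X \<alpha> n) = x"
proof (induction n)
  case 0
  then show ?case using assms by (simp add: Comp_Id_right)
next
  case (Suc n)
  have "Comp C X X Y x (iter C X \<alpha> (Suc n)) = Comp C X X Y (Comp C X X Y x \<alpha>) (iter C X \<alpha> n)"
    using assms(1-4) by (simp add: Comp_assoc iter_hom)
  then show ?case using assms(5) Suc by simp
qed

end

text \<open>The supremum operator is a Hilbert choice among least upper bounds; antisymmetry leaves
  only one candidate.\<close>

lemma (in partial_order) sup_eqI:
  assumes "is_lub L s A"
  shows "\<Squnion>A = s"
  unfolding sup_def using assms by (blast intro: some_equality least_unique)

text \<open>Since \<open>c n\<close> lies below \<open>c (Suc n)\<close>, dropping the first term
  does not change the set of upper bounds.\<close>

lemma omega_chain_shift_lub: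
  assumes "partial_order L" "omega_chain L c" "is_lub L s (range c)"
  shows "is_lub L s (range (\<lambda>n. c (Suc n)))"
proof -
  interpret partial_order L by fact
  have carr: "c n \<in> carrier L" and step: "c n \<sqsubseteq>\<^bsub>L\<^esub> c (Suc n)" for n
    using assms(2) by (auto simp: omega_chain_def)
  have "c n \<sqsubseteq>\<^bsub>L\<^esub> y" if "y \<in> carrier L" "\<And>n. c (Suc n) \<sqsubseteq>\<^bsub>L\<^esub> y" for y n
    using le_trans[OF step that(2) carr carr that(1)] .
  then have "Upper L (range (\<lambda>n. c (Suc n))) = Upper L (range c)"
    using carr by (auto simp: Upper_def)
  then show ?thesis using assms(3) by simp
qed

context cppo_enriched
begin

text \<open>The Kleene approximants, starting at bottom, of the map that precomposes with
  \<open>\<alpha>\<close>.\<close>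

definition bot_chain :: "'o \<Rightarrow> 'o \<Rightarrow> 'a \<Rightarrow> nat \<Rightarrow> 'a" where
  "bot_chain z X \<alpha> n = Comp K X X z \<bottom>\<^bsub>P X z\<^esub> (iter K X \<alpha> n)"

lemma bottom_hom:
  assumes "X \<in> Ob K" "Y \<in> Ob K"
  shows "\<bottom>\<^bsub>P X Y\<^esub> \<in> Hom K X Y"
    and "\<And>f. f \<in> Hom K X Y \<Longrightarrow> \<bottom>\<^bsub>P X Y\<^esub> \<sqsubseteq>\<^bsub>P X Y\<^esub> f"
proof -
  interpret partial_order "P X Y" using hom_poset assms .
  interpret weak_partial_order_bottom "P X Y" by unfold_locales (rule hom_bottom[OF assms])
  show "\<bottom>\<^bsub>P X Y\<^esub> \<in> Hom K X Y"
    using bottom_closed carrier_hom[OF assms] by simp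
  show "\<bottom>\<^bsub>P X Y\<^esub> \<sqsubseteq>\<^bsub>P X Y\<^esub> f" if "f \<in> Hom K X Y" for f
    using bottom_lower that carrier_hom[OF assms] by simp
qed

lemma bot_chain_Suc:
  assumes "X \<in> Ob K" "z \<in> Ob K" "\<alpha> \<in> Hom K X X"
  shows "bot_chain z X \<alpha> (Suc n) = Comp K X X z (bot_chain z X \<alpha> n) \<alpha>"
  using assms Comp_iter_commute[of X X \<alpha> \<alpha> \<alpha> n]
  by (simp add: bot_chain_def Comp_assoc iter_hom bottom_hom)

lemma omega_chain_bot_chain:
  assumes "X \<in> Ob K" "z \<in> Ob K" "\<alpha> \<in> Hom K X X"
  shows "omega_chain (P X z) (bot_chain z X \<alpha>)"
  unfolding omega_chain_def
proof (intro allI conjI)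
  fix n
  show "bot_chain z X \<alpha> n \<in> carrier (P X z)"
    using assms by (simp add: bot_chain_def carrier_hom Comp_hom bottom_hom iter_hom)
  \<comment> \<open>Bottom lies below its composite with \<open>\<alpha>\<close>; precomposing both
    with the \<open>n\<close>-th power of \<open>\<alpha>\<close> keeps the order.\<close>
  have "bot_chain z X \<alpha> n
      \<sqsubseteq>\<^bsub>P X z\<^esub> Comp K X X z (Comp K X X z \<bottom>\<^bsub>P X z\<^esub> \<alpha>) (iter K X \<alpha> n)"
    unfolding bot_chain_def
    using assms by (intro Comp_mono_left) (auto intro: Comp_hom bottom_hom iter_hom)
  also have "Comp K X X z (Comp K X X z \<bottom>\<^bsub>P X z\<^esub> \<alpha>) (iter K X \<alpha> n) = bot_chain z X \<alpha> (Suc n)"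
    using assms by (simp add: bot_chain_def Comp_assoc bottom_hom iter_hom)
  finally show "bot_chain z X \<alpha> n \<sqsubseteq>\<^bsub>P X z\<^esub> bot_chain z X \<alpha> (Suc n)" .
qed

lemma tr_is_lub:
  assumes "X \<in> Ob K" "z \<in> Ob K" "\<alpha> \<in> Hom K X X"
  shows "is_lub (P X z) (tr K P z X \<alpha>) (range (bot_chain z X \<alpha>))"
proof -
  interpret partial_order "P X z" using hom_poset assms(1,2) .
  \<comment> \<open>Completeness must first provide some least upper bound; only then is the choice
    inside \<open>tr\<close> known to pick one.\<close>
  obtain s where s: "is_lub (P X z) s (range (bot_chain z X \<alpha>))"
    using hom_chain_sup omega_chain_bot_chain assms by blast
  moreover have "tr K P z X \<alpha> = s"
    using sup_eqI[OF s] by (simp add: tr_def bot_chain_def[abs_def])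
  ultimately show ?thesis by simp
qed

lemma tr_hom:
  assumes "X \<in> Ob K" "z \<in> Ob K" "\<alpha> \<in> Hom K X X"
  shows "tr K P z X \<alpha> \<in> Hom K X z"
  using tr_is_lub[OF assms] carrier_hom assms by (auto simp: least_def Upper_def)

lemma tr_fixed:
  assumes "X \<in> Ob K" "z \<in> Ob K" "\<alpha> \<in> Hom K X X"
  shows "Comp K X X z (tr K P z X \<alpha>) \<alpha> = tr K P z X \<alpha>"
proof -
  interpret partial_order "P X z" using hom_poset assms(1,2) .
  have "is_lub (P X z) (Comp K X X z (tr K P z X \<alpha>) \<alpha>) (range (\<lambda>n. bot_chain z X \<alpha> (Suc n)))"
    using Comp_sup_left[OF assms(1,1,2,3) omega_chain_bot_chain tr_is_lub] assms
    by (simp add: bot_chain_Suc)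
  moreover have "is_lub (P X z) (tr K P z X \<alpha>) (range (\<lambda>n. bot_chain z X \<alpha> (Suc n)))"
    by (rule omega_chain_shift_lub[OF partial_order_axioms omega_chain_bot_chain[OF assms]
          tr_is_lub[OF assms]])
  ultimately show ?thesis by (rule least_unique)
qed

text \<open>This justifies the notation \<open>\<mu>x. (x \<cdot> \<alpha>)\<close>: the supremum of
  the approximants lies below every fixed point because each approximant does.\<close>

lemma tr_least_fixed:
  assumes "X \<in> Ob K" "z \<in> Ob K" "\<alpha> \<in> Hom K X X"
  shows "least (P X z) (tr K P z X \<alpha>) (fps (P X z) (\<lambda>x. Comp K X X z x \<alpha>))"
proof -
  interpret partial_order "P X z" using hom_poset assms(1,2) .
  have "tr K P z X \<alpha> \<sqsubseteq>\<^bsub>P X z\<^esub> x" if "x \<in> Hom K X z" "Comp K X X z x \<alpha> = x" for x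
  proof -
    have "bot_chain z X \<alpha> n \<sqsubseteq>\<^bsub>P X z\<^esub> x" for n
    proof -
      have "bot_chain z X \<alpha> n \<sqsubseteq>\<^bsub>P X z\<^esub> Comp K X X z x (iter K X \<alpha> n)"
        unfolding bot_chain_def
        using assms that by (intro Comp_mono_left) (auto intro: bottom_hom iter_hom)
      then show ?thesis using assms that by (simp add: Comp_iter_fixed)
    qed
    then have "x \<in> Upper (P X z) (range (bot_chain z X \<alpha>))"
      using that carrier_hom assms by (auto simp: Upper_def)
    then show ?thesis using tr_is_lub[OF assms] by (simp add: least_def)
  qed
  then show ?thesis
    \<comment> \<open>\<open>fps\<close> is stated with the equivalence of the order structure,
      which \<open>eq_is_equal\<close> turns into equality.\<close>
    using tr_hom[OF assms] tr_fixed[OF assms] carrier_hom[OF assms(1,2)]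
    by (auto simp: least_def fps_def eq_is_equal)
qed

text \<open>Here \<open>h\<close> is any morphism of \<open>K\<close>; what the image of
  \<open>sharp\<close> contributes is isolated in \<open>strict\<close>.\<close>

lemma tr_uniform:
  assumes "X \<in> Ob K" "Y \<in> Ob K" "z \<in> Ob K" "\<alpha> \<in> Hom K X X" "\<beta> \<in> Hom K Y Y" "h \<in> Hom K X Y"
    and comm: "Comp K X X Y h \<alpha> = Comp K X Y Y \<beta> h"
    and strict: "Comp K X Y z \<bottom>\<^bsub>P Y z\<^esub> h = \<bottom>\<^bsub>P X z\<^esub>"
  shows "Comp K X Y z (tr K P z Y \<beta>) h = tr K P z X \<alpha>"
proof -
  interpret partial_order "P X z" using hom_poset assms(1,3) .
  have "Comp K X Y z (bot_chain z Y \<beta> n) h = bot_chain z X \<alpha> n" for n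
  proof -
    have "Comp K X Y z (bot_chain z Y \<beta> n) h
        = Comp K X Y z \<bottom>\<^bsub>P Y z\<^esub> (Comp K X X Y h (iter K X \<alpha> n))"
      using assms(1-6) Comp_iter_commute[OF assms(1,2,4-6) comm, of n]
      by (simp add: bot_chain_def Comp_assoc bottom_hom iter_hom)
    \<comment> \<open>Reassociating brings bottom next to \<open>h\<close>, so that
      \<open>strict\<close> absorbs \<open>h\<close>.\<close>
    also have "\<dots> = Comp K X X z (Comp K X Y z \<bottom>\<^bsub>P Y z\<^esub> h) (iter K X \<alpha> n)"
      using assms(1-6) by (simp add: Comp_assoc bottom_hom iter_hom)
    finally show ?thesis by (simp add: strict bot_chain_def)
  qed
  then have "is_lub (P X z) (Comp K X Y z (tr K P z Y \<beta>) h) (range (bot_chain z X \<alpha>))"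
    using Comp_sup_left[OF assms(1-3,6) omega_chain_bot_chain[OF assms(2,3,5)]
        tr_is_lub[OF assms(2,3,5)]]
    by simp
  then show ?thesis using tr_is_lub assms(1,3,4) by (blast intro: least_unique)
qed

end

lemma (in monad) sharp_hom:
  assumes "X \<in> Ob C" "Y \<in> Ob C" "f \<in> Hom C X Y"
  shows "sharp C T X Y f \<in> Hom (kleisli C T) X Y"
  using assms T.source.Comp_hom T.map_ob unit.component by (simp add: sharp_def kleisli_def)

theorem theorem10:
  fixes C :: "('o, 'a) cat" and T :: "('o, 'a) monad_data" and z :: 'o
    and P :: "'o \<Rightarrow> 'o \<Rightarrow> 'a gorder"
  assumes "category C"
    and "initial_object C z"
    and "monad C T"
    and "cppo_enriched (kleisli C T) P"
    and "\<And>X Y Z f. \<lbrakk>X \<in> Ob C; Y \<in> Ob C; Z \<in> Ob C; f \<in> Hom C X Y\<rbrakk> \<Longrightarrow>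
      Comp (kleisli C T) X Y Z \<bottom>\<^bsub>P Y Z\<^esub> (sharp C T X Y f) = \<bottom>\<^bsub>P X Z\<^esub>"
  shows "(\<forall>X \<in> Ob C. \<forall>\<alpha> \<in> Hom (kleisli C T) X X.
      is_lub (P X z) (tr (kleisli C T) P z X \<alpha>)
        (range (\<lambda>n. Comp (kleisli C T) X X z \<bottom>\<^bsub>P X z\<^esub> (iter (kleisli C T) X \<alpha> n))) \<and>
      least (P X z) (tr (kleisli C T) P z X \<alpha>)
        (fps (P X z) (\<lambda>x. Comp (kleisli C T) X X z x \<alpha>))) \<and>
    coalgebraic_trace_operator C T z (tr (kleisli C T) P z)"
proof -
  interpret monad C T by fact
  interpret K: cppo_enriched "kleisli C T" P by fact
  have Ob: "Ob (kleisli C T) = Ob C" by (simp add: kleisli_def)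
  have z: "z \<in> Ob C" using assms(2) by (simp add: initial_object_def)
  have "fixed_point_operator (kleisli C T) z (tr (kleisli C T) P z)"
    unfolding fixed_point_operator_def using z K.tr_hom K.tr_fixed by (simp add: Ob)
  moreover have "uniform_wrt C (kleisli C T) (sharp C T) z (tr (kleisli C T) P z)"
    unfolding uniform_wrt_def
  proof (intro ballI impI)
    fix X Y \<alpha> \<beta> h
    assume X: "X \<in> Ob C" and Y: "Y \<in> Ob C" and h: "h \<in> Hom C X Y"
      and "\<alpha> \<in> Hom (kleisli C T) X X" "\<beta> \<in> Hom (kleisli C T) Y Y"
        "Comp (kleisli C T) X X Y (sharp C T X Y h) \<alpha> =
          Comp (kleisli C T) X Y Y \<beta> (sharp C T X Y h)"
    \<comment> \<open>The assumption on bottom, taken at codomain \<open>z\<close>, is the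
      strictness that \<open>K.tr_uniform\<close> asks of the Kleisli image of
      \<open>h\<close>.\<close>
    then show "Comp (kleisli C T) X Y z (tr (kleisli C T) P z Y \<beta>) (sharp C T X Y h) =
        tr (kleisli C T) P z X \<alpha>"
      using sharp_hom[OF X Y h] assms(5)[OF X Y z h] z by (intro K.tr_uniform) (simp_all add: Ob)
  qed
  ultimately show ?thesis
    unfolding coalgebraic_trace_operator_def
    using K.tr_is_lub[unfolded K.bot_chain_def[abs_def]] K.tr_least_fixed z
    by (auto simp: Ob)
qed

end
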